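(* Let $\mathbf E^1,\dots,\mathbf E^N\in\mathbb R^{nH}$ be calibration trajectories, let $s_1,\dots,s_M:\mathbb R^{nH}\to\mathbb R$ be scores, and for $q=(q_1,\dots,q_M)$ let $\mathcal E_q=\{\mathbf e: s_h(\mathbf e)\le q_h,\ h=1,\dots,M\}$. Define $D_h(q_h):=\{i: s_h(\mathbf E^i)>q_h\}$ and $D_\cup(q):=\bigcup_{h=1}^M D_h(q_h)$. Let $q^{\rm mod}$ be any modular tube parameter satisfying $|D_h(q_h^{\rm mod})|\le r_h$ for all $h=1,\dots,M$. Then $$|D_\cup(q^{\rm mod})|\le\sum_{h=1}^M r_h.$$ Consequently, $q^{\rm mod}$ is feasible for the collective discard problem $$\min_q\ \Phi_{\rm MPC}(q)\quad\text{s.t.}\quad\sum_{i=1}^N\mathbf 1\{\mathbf E^i\notin\mathcal E_q\}\le r_\cup$$ whenever $r_\cup\ge\sum_{h=1}^M r_h$. Hence the optimal value of the collective problem is no larger than $\Phi_{\rm MPC}(q^{\rm mod})$, for any shared monotone tightening objective $\Phi_{\rm MPC}$.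
   Context: The numbers $r_1,\dots,r_M$ and $r_\cup$ are nonnegative integers (discard budgets). A "shared monotone tightening objective" is a real-valued function $\Phi_{\rm MPC}$ of the threshold vector $q\in\mathbb R^M$ that is monotone (nondecreasing as the tube grows) and is the same function used to evaluate both the modular and the collective tubes. *)

theory Defs
  imports "HOL-Analysis.Analysis"
begin

definition tube :: "('m::finite \<Rightarrow> 'e \<Rightarrow> real) \<Rightarrow> real ^ 'm \<Rightarrow> 'e set" where
  "tube s q = {e. \<forall>h. s h e \<le> q $ h}"

definition discards :: "nat \<Rightarrow> (nat \<Rightarrow> 'e) \<Rightarrow> ('e \<Rightarrow> real) \<Rightarrow> real \<Rightarrow> nat set" where
  "discards N E sh t = {i \<in> {1..N}. sh (E i) > t}"

definition union_discards ::
    "nat \<Rightarrow> (nat \<Rightarrow> 'e) \<Rightarrow> ('m::finite \<Rightarrow> 'e \<Rightarrow> real) \<Rightarrow> real ^ 'm \<Rightarrow> nat set" where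
  "union_discards N E s q = (\<Union>h. discards N E (s h) (q $ h))"

definition collective_feasible ::
    "nat \<Rightarrow> (nat \<Rightarrow> 'e) \<Rightarrow> ('m::finite \<Rightarrow> 'e \<Rightarrow> real) \<Rightarrow> nat \<Rightarrow> (real ^ 'm) set" where
  "collective_feasible N E s rc = {q. (\<Sum>i = 1..N. of_bool (E i \<notin> tube s q)) \<le> rc}"

text \<open>The minimum need not be attained and the objective may be unbounded below, so the
  optimal value is the infimum in the extended reals.\<close>

definition collective_value ::
    "nat \<Rightarrow> (nat \<Rightarrow> 'e) \<Rightarrow> ('m::finite \<Rightarrow> 'e \<Rightarrow> real) \<Rightarrow> nat \<Rightarrow> (real ^ 'm \<Rightarrow> real) \<Rightarrow> ereal" where
  "collective_value N E s rc \<Phi> = (INF q \<in> collective_feasible N E s rc. ereal (\<Phi> q))"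

text \<open>Objectives are required to be monotone for the componentwise order on \<open>real ^ 'm\<close>.  This is
  implied by monotonicity with respect to inclusion of tubes:\<close>

lemma tube_mono: "q \<le> q' \<Longrightarrow> tube s q \<subseteq> tube s q'"
  by (auto simp: tube_def less_eq_vec_def intro: order_trans)

lemma mono_if_tube_mono:
  fixes \<Phi> :: "real ^ 'm::finite \<Rightarrow> real"
  assumes "\<And>q q'. tube s q \<subseteq> tube s q' \<Longrightarrow> \<Phi> q \<le> \<Phi> q'"
  shows "mono \<Phi>"
  by (intro monoI assms tube_mono)

end

theory Submission
  imports Defs
begin

text \<open>A trajectory leaves the tube exactly when some score exceeds its threshold, so the
  collective constraint counts the union of the per-score discard sets
  (\<open>union_discards_eq\<close>). The union bound (\<open>card_union_discards_le\<close>) keeps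
  this count within the sum of the modular budgets, so \<open>qmod\<close> is feasible, and an
  infimum never exceeds the value at a feasible point.\<close>

lemma union_discards_eq: "union_discards N E s q = {i \<in> {1..N}. E i \<notin> tube s q}"
  by (auto simp: union_discards_def discards_def tube_def not_le)

text \<open>Summing indicators over a finite index range counts the indices where they hold; this
  puts the constraint in the form that the union bound controls.\<close>

lemma collective_feasible_iff_card:
  "q \<in> collective_feasible N E s rc \<longleftrightarrow> card (union_discards N E s q) \<le> rc"
  by (simp add: collective_feasible_def union_discards_eq Int_def)

text \<open>An index discarded by several scores counts once in the union but repeatedly in the sum,
  so overlaps only help.\<close>

lemma card_union_discards_le:
  fixes s :: "'m::finite \<Rightarrow> 'e \<Rightarrow> real"
  assumes "\<And>h. card (discards N E (s h) (q $ h)) \<le> r h"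
  shows "card (union_discards N E s q) \<le> (\<Sum>h\<in>UNIV. r h)"
proof -
  have "card (union_discards N E s q) \<le> (\<Sum>h\<in>UNIV. card (discards N E (s h) (q $ h)))"
    unfolding union_discards_def by (intro card_UN_le) simp
  also have "\<dots> \<le> (\<Sum>h\<in>UNIV. r h)"
    by (intro sum_mono assms)
  finally show ?thesis .
qed

lemma collective_value_le:
  "q \<in> collective_feasible N E s rc \<Longrightarrow> collective_value N E s rc \<Phi> \<le> ereal (\<Phi> q)"
  unfolding collective_value_def by (rule INF_lower)

theorem proposition15:
  fixes N :: nat
    and E :: "nat \<Rightarrow> real ^ ('n::finite \<times> 'H::finite)"
    and s :: "'m::finite \<Rightarrow> real ^ ('n \<times> 'H) \<Rightarrow> real"
    and r :: "'m \<Rightarrow> nat"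
    and qmod :: "real ^ 'm"
  assumes modular: "\<And>h. card (discards N E (s h) (qmod $ h)) \<le> r h"
  shows "card (union_discards N E s qmod) \<le> (\<Sum>h\<in>UNIV. r h)
    \<and> (\<forall>rc::nat. rc \<ge> (\<Sum>h\<in>UNIV. r h) \<longrightarrow>
          qmod \<in> collective_feasible N E s rc
        \<and> (\<forall>\<Phi> :: real ^ 'm \<Rightarrow> real. mono \<Phi> \<longrightarrow>
              collective_value N E s rc \<Phi> \<le> ereal (\<Phi> qmod)))"
  using card_union_discards_le[where r = r, OF modular]
  \<comment> \<open>The value bound also reduces to feasibility of \<open>qmod\<close>, which is the
    cardinality bound chained with the lower bound on \<open>rc\<close>.\<close>
  by (auto simp: collective_feasible_iff_card intro!: collective_value_le)

end
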